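(* Let $n\in\mathbb{N}$. The point set $P$, the hyperbolic obstruction set $H$ (which depends on $n$), and the set $T$ (the "right half" of the Janssen bow tie) satisfy $$P\subset H\subset T.$$
   Context: $\mathbb{N}=\{1,2,3,\dots\}$ and $\mathbb{R}_+=(0,\infty)$. The set $P$: consider integers $\mu,k,r\in\mathbb{N}$ satisfying $$\mu\ge 3,\quad r\ge 2,\quad k\in\{1,2,\dots,\mu-2\},\quad \gcd(k,\mu)=1,\quad \gcd(k,r)=1. \qquad ( * )$$ Then $P=\left\{\left(\frac1\mu,\ \mu-\frac{k}{r}\right)\in\mathbb{R}_+^2 : \mu,r,k \text{ satisfy } ( * )\right\}$. To a point $(a_0,b_0)=\left(\frac1\mu,\mu-\frac kr\right)\in P$ one associates $p=r\mu-k$ and $q=r\mu$, so that $a_0b_0=p/q$. The set $H$: for $(a_0,b_0)\in P$ with associated $\mu,r,k,p,q$, let $$H_{(a_0,b_0)}=\left\{(a,b)\in\mathbb{R}_+^2 : ab=\frac pq \text{ and } |b-b_0|\le\frac{1}{nq}\bigl(\mu-(q-p+1)\bigr)\right\},$$ and $H=\bigcup_{(a_0,b_0)\in P}H_{(a_0,b_0)}$. The set $T$: for each integer $N\ge2$ let $$T_N=\left\{(a,b)\in\mathbb{R}_+^2 : \frac{N+1}{1+a}\le b\le\frac{N}{1-a},\ ab<1\right\},$$ and $T=\bigcup_{N=2}^\infty T_N$. *)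

theory Defs
  imports Complex_Main
begin

definition admissible :: "nat \<Rightarrow> nat \<Rightarrow> nat \<Rightarrow> bool" where
  "admissible \<mu> k r \<longleftrightarrow>
     3 \<le> \<mu> \<and> 2 \<le> r \<and> k \<in> {1..\<mu> - 2} \<and> coprime k \<mu> \<and> coprime k r"

definition base_point :: "nat \<Rightarrow> nat \<Rightarrow> nat \<Rightarrow> real \<times> real" where
  "base_point \<mu> k r = (1 / real \<mu>, real \<mu> - real k / real r)"

text \<open>The integers \<open>p\<close> and \<open>q\<close> attached to a base point live in \<open>int\<close>, so that no subtraction
  truncates.\<close>

definition p_num :: "nat \<Rightarrow> nat \<Rightarrow> nat \<Rightarrow> int" where
  "p_num \<mu> k r = int r * int \<mu> - int k"

definition q_den :: "nat \<Rightarrow> nat \<Rightarrow> int" where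
  "q_den \<mu> r = int r * int \<mu>"

definition P_set :: "(real \<times> real) set" where
  "P_set = {base_point \<mu> k r | \<mu> k r.
      admissible \<mu> k r \<and> fst (base_point \<mu> k r) > 0 \<and> snd (base_point \<mu> k r) > 0}"

text \<open>The parameters \<open>(\<mu>, k, r)\<close> are recovered from the base point. They are unique by
  \<open>base_point_inj\<close> below, so the existential quantifier only names them.\<close>

definition H_at :: "nat \<Rightarrow> real \<times> real \<Rightarrow> (real \<times> real) set" where
  "H_at n x0 = {(a, b). 0 < a \<and> 0 < b \<and>
     (\<exists>\<mu> k r. admissible \<mu> k r \<and> x0 = base_point \<mu> k r \<and>
       (let p = p_num \<mu> k r; q = q_den \<mu> r in
          a * b = of_int p / of_int q \<and>
          \<bar>b - snd x0\<bar> \<le> 1 / (real n * of_int q) * of_int (int \<mu> - (q - p + 1))))}"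

definition H_set :: "nat \<Rightarrow> (real \<times> real) set" where
  "H_set n = (\<Union>x0\<in>P_set. H_at n x0)"

text \<open>Division by zero at \<open>a = 1\<close> is harmless: there \<open>a * b < 1\<close> already contradicts
  \<open>(N + 1) / (1 + a) \<le> b\<close>. For \<open>a > 1\<close> the upper bound is negative.\<close>

definition T_strip :: "nat \<Rightarrow> (real \<times> real) set" where
  "T_strip N = {(a, b). 0 < a \<and> 0 < b \<and>
     (real N + 1) / (1 + a) \<le> b \<and> b \<le> real N / (1 - a) \<and> a * b < 1}"

definition T_set :: "(real \<times> real) set" where
  "T_set = (\<Union>N\<in>{2..}. T_strip N)"

lemma base_point_inj:
  assumes 1: "admissible \<mu> k r" and 2: "admissible \<mu>' k' r'"
    and eq: "base_point \<mu> k r = base_point \<mu>' k' r'"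
  shows "\<mu> = \<mu>' \<and> k = k' \<and> r = r'"
proof -
  have "\<mu> = \<mu>'" using 1 2 eq by (auto simp: base_point_def admissible_def)
  moreover have r: "r > 0" "r' > 0" using 1 2 by (auto simp: admissible_def)
  ultimately have "real k / real r = real k' / real r'"
    using eq by (auto simp: base_point_def)
  hence "real (k * r') = real (k' * r)" using r by (simp add: field_simps)
  hence x: "k * r' = k' * r" using of_nat_eq_iff by blast
  have c: "coprime k r" "coprime k' r'" using 1 2 by (auto simp: admissible_def)
  have "r dvd r'" using c(1) x
    by (metis coprime_commute coprime_dvd_mult_right_iff dvd_triv_right)
  moreover have "r' dvd r" using c(2) x
    by (metis coprime_commute coprime_dvd_mult_right_iff dvd_triv_right)
  ultimately have "r = r'" by (rule dvd_antisym)
  thus ?thesis using x r \<open>\<mu> = \<mu>'\<close> by simp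
qed

end

theory Submission
  imports Defs
begin

text \<open>On the hyperbola \<open>a b = 1 - c\<close> with \<open>c = k / q\<close>, membership in the \<open>N\<close>-th strip is the linear
  condition \<open>N + c \<le> b \<le> N + 1 - c\<close>. Since \<open>b\<^sub>0 = \<mu> - k \<mu> / q\<close> and the deviation
  is at most \<open>(\<mu> - k - 1) / q\<close>, after multiplication by \<open>q = r \<mu>\<close> this follows, for
  \<open>N = \<mu> - M\<close>, from \<open>(M - 1) r \<le> k - 1\<close> and \<open>k + 1 \<le> M r\<close>. As \<open>r\<close> does not divide \<open>k\<close>,
  these hold for \<open>M = \<lceil>k / r\<rceil>\<close>.\<close>

text \<open>Clearing the denominators \<open>1 + a\<close> and \<open>1 - a\<close> and replacing
  \<open>a * b\<close> by \<open>1 - c\<close> leaves exactly \<open>lo\<close> and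
  \<open>hi\<close>.\<close>

lemma mem_T_stripI:
  assumes a: "0 < a" and N: "1 \<le> N" and c: "0 < c"
    and ab: "a * b = 1 - c" and lo: "real N + c \<le> b" and hi: "b \<le> real N + 1 - c"
  shows "(a, b) \<in> T_strip N"
proof -
  have b: "1 < b" using lo N c by linarith
  \<comment> \<open>\<open>a < 1\<close> makes \<open>1 - a\<close> positive, so the upper bound of
    the strip can be multiplied out.\<close>
  have "a * 1 \<le> a * b" using a b by (intro mult_left_mono) auto
  hence "a < 1" using ab c by linarith
  thus ?thesis using a b c ab lo hi
    by (simp add: T_strip_def divide_le_eq le_divide_eq algebra_simps)
qed

lemma p_num_div_q_den:
  assumes "admissible \<mu> k r"
  shows "real_of_int (p_num \<mu> k r) / real_of_int (q_den \<mu> r) = 1 - real k / (real r * real \<mu>)"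
  using assms by (auto simp: admissible_def p_num_def q_den_def field_simps)

lemma radius_eq:
  "1 / (real n * of_int (q_den \<mu> r)) * of_int (int \<mu> - (q_den \<mu> r - p_num \<mu> k r + 1))
    = (real \<mu> - real k - 1) / (real n * (real r * real \<mu>))"
  by (simp add: p_num_def q_den_def algebra_simps diff_divide_distrib)

lemma P_set_subset_H_set: "P_set \<subseteq> H_set n"
proof
  fix x assume x: "x \<in> P_set"
  then obtain \<mu> k r where adm: "admissible \<mu> k r" and x_eq: "x = base_point \<mu> k r"
    and pos: "fst x > 0" "snd x > 0"
    by (auto simp: P_set_def)
  have prod: "fst x * snd x = of_int (p_num \<mu> k r) / of_int (q_den \<mu> r)"
    using adm unfolding p_num_div_q_den[OF adm]
    by (auto simp: x_eq base_point_def admissible_def field_simps)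
  \<comment> \<open>A base point is the centre of its own arc, so only a nonnegative radius is
    required. It comes from \<open>k \<le> \<mu> - 2\<close>; for \<open>n = 0\<close> the quotient
    is 0 by convention.\<close>
  have "0 \<le> (real \<mu> - real k - 1) / (real n * (real r * real \<mu>))"
    using adm by (auto simp: admissible_def intro!: divide_nonneg_nonneg)
  hence "\<bar>snd x - snd x\<bar>
      \<le> 1 / (real n * of_int (q_den \<mu> r)) * of_int (int \<mu> - (q_den \<mu> r - p_num \<mu> k r + 1))"
    unfolding radius_eq by simp
  hence "(fst x, snd x) \<in> H_at n x"
    unfolding H_at_def Let_def using pos adm x_eq prod by blast
  thus "x \<in> H_set n" using x by (auto simp: H_set_def)
qed

text \<open>The distance bound is the radius for \<open>n = 1\<close>, the largest one; larger
  \<open>n\<close> only shrink the arc.\<close>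

lemma near_base_point_mem_T_set:
  assumes adm: "admissible \<mu> k r" and a: "0 < a"
    and ab: "a * b = 1 - real k / (real r * real \<mu>)"
    and dist: "\<bar>b - (real \<mu> - real k / real r)\<bar> \<le> (real \<mu> - real k - 1) / (real r * real \<mu>)"
  shows "(a, b) \<in> T_set"
proof -
  have r: "2 \<le> r" and \<mu>: "3 \<le> \<mu>" and k: "1 \<le> k" "k + 2 \<le> \<mu>" and cop: "coprime k r"
    using adm by (auto simp: admissible_def)
  define d where "d = k div r"
  \<comment> \<open>Here \<open>d + 1\<close> is the ceiling of \<open>k / r\<close>, because
    \<open>r\<close> does not divide \<open>k\<close>.\<close>
  define N where "N = \<mu> - 1 - d"
  have "\<not> r dvd k"
    using cop r by (auto dest: coprime_common_divisor[of k r r])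
  hence "0 < k mod r" by (simp add: dvd_eq_mod_eq_0)
  moreover have "k mod r < r" using r by simp
  moreover have "k = d * r + k mod r" by (simp add: d_def)
  ultimately have d: "d * r + 1 \<le> k" "k + 1 \<le> d * r + r" by linarith+
  \<comment> \<open>From \<open>2 * d \<le> k - 1 \<le> \<mu> - 3\<close> the subtraction in
    \<open>N\<close> does not truncate and \<open>N \<ge> d + 2\<close>.\<close>
  have "d * 2 \<le> d * r" using r by simp
  hence "2 * d + 3 \<le> \<mu>" using d k by linarith
  hence N: "2 \<le> N" and N_eq: "real N = real \<mu> - 1 - real d"
    using \<mu> by (auto simp: N_def of_nat_diff)
  define q where "q = real r * real \<mu>"
  have q: "0 < q" using r \<mu> by (simp add: q_def)
  have kr: "real k / real r = real k * real \<mu> / q" using r \<mu> by (simp add: q_def)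
  have dist': "\<bar>b * q - (real \<mu> * q - real k * real \<mu>)\<bar> \<le> real \<mu> - real k - 1"
  proof -
    have "\<bar>b * q - (real \<mu> * q - real k * real \<mu>)\<bar> = \<bar>b - (real \<mu> - real k / real r)\<bar> * q"
      using q by (simp add: kr abs_mult_pos' [symmetric] abs_mult_pos field_simps)
    also have "\<dots> \<le> real \<mu> - real k - 1"
      using dist q by (simp add: q_def pos_le_divide_eq)
    finally show ?thesis .
  qed
  have "real (d * r + 1) * real \<mu> \<le> real k * real \<mu>"
    "real (k + 1) * real \<mu> \<le> real (d * r + r) * real \<mu>"
    using d by (intro mult_right_mono; simp only: of_nat_le_iff of_nat_0_le_iff)+
  hence M: "real d * q + real \<mu> \<le> real k * real \<mu>"
    "real k * real \<mu> + real \<mu> \<le> real d * q + q"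
    by (simp_all add: q_def algebra_simps)
  \<comment> \<open>The lower bound uses the second inequality of \<open>M\<close>, the upper bound
    the first; each holds with slack 1.\<close>
  have "real N * q + real k \<le> b * q" "b * q \<le> (real N + 1) * q - real k"
    using dist' M by (auto simp: N_eq algebra_simps abs_le_iff)
  hence "real N + real k / q \<le> b" "b \<le> real N + 1 - real k / q"
    using q by (simp_all add: field_simps)
  hence "(a, b) \<in> T_strip N"
    using a ab N k q by (intro mem_T_stripI[where c = "real k / q"]) (auto simp: q_def)
  thus ?thesis using N by (auto simp: T_set_def)
qed

lemma H_set_subset_T_set:
  assumes "n \<ge> 1"
  shows "H_set n \<subseteq> T_set"
proof
  fix x assume "x \<in> H_set n"
  then obtain x0 where "x \<in> H_at n x0" by (auto simp: H_set_def)
  then obtain a b \<mu> k r where x: "x = (a, b)" and a: "0 < a" and adm: "admissible \<mu> k r"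
    and x0: "x0 = base_point \<mu> k r"
    and ab: "a * b = of_int (p_num \<mu> k r) / of_int (q_den \<mu> r)"
    and dist: "\<bar>b - snd x0\<bar> \<le> (real \<mu> - real k - 1) / (real n * (real r * real \<mu>))"
    unfolding H_at_def Let_def radius_eq by auto
  have "1 * (real r * real \<mu>) \<le> real n * (real r * real \<mu>)"
    using assms by (intro mult_right_mono) auto
  hence "(real \<mu> - real k - 1) / (real n * (real r * real \<mu>))
      \<le> (real \<mu> - real k - 1) / (real r * real \<mu>)"
    using adm by (intro divide_left_mono) (auto simp: admissible_def)
  thus "x \<in> T_set"
    using near_base_point_mem_T_set[OF adm a] ab dist
    unfolding x x0 p_num_div_q_den[OF adm] by (simp add: base_point_def)
qed

theorem theorem2p4:
  fixes n :: nat
  assumes "n \<ge> 1"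
  shows "P_set \<subseteq> H_set n \<and> H_set n \<subseteq> T_set"
  using P_set_subset_H_set H_set_subset_T_set[OF assms] by blast

end
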